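(* Let $d\in\mathbb{Z}_{>0}$. For $0<q<1$ let $\xi_q$ be the probability measure on the finite set $\mathcal{P}_d$ of integer partitions of $d$ given by $$\xi_q(\lambda)=\frac{p(\lambda)\,w_q(\lambda)}{\sum_{\kappa\in\mathcal{P}_d}p(\kappa)\,w_q(\kappa)},\qquad \lambda\in\mathcal{P}_d,$$ where $p(\lambda)$ and $w_q(\lambda)$ are as defined in the context. Then, as $q\to0^+$, the one-parameter family of measures $(\xi_q)$ converges weakly to the Dirac measure $\delta_{(d)}$ at the one-part partition $(d)\in\mathcal{P}_d$.
   Context: For a partition $\lambda=(\lambda_1\ge\cdots\ge\lambda_{\ell(\lambda)}>0)$, $\ell(\lambda)$ is its number of parts, and $|\mathrm{aut}(\lambda)|:=\prod_{i\ge1}m_i(\lambda)!$, where $m_i(\lambda)$ is the number of parts of $\lambda$ equal to $i$. For a positive integer $m$, $p(m)$ is the number of integer partitions of $m$, and for a partition $\lambda$, $p(\lambda):=\prod_{j=1}^{\ell(\lambda)}p(\lambda_j)$. For $0<q<1$ and $\lambda\in\mathcal{P}_d$, $$w_q(\lambda):=\frac{1}{|\mathrm{aut}(\lambda)|}\sum_{\sigma\in S_{\ell(\lambda)}}\ \prod_{j=1}^{\ell(\lambda)}\frac{1}{q^{-\sum_{i=1}^{j}\lambda_{\sigma(i)}}-1}.$$ The set $\mathcal{P}_d$ is finite and carries the discrete topology and $\sigma$-algebra. The Dirac measure is $\delta_x(A)=1$ if $x\in A$ and $0$ otherwise. *)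

theory Defs
  imports "HOL-Probability.Probability" "HOL-Combinatorics.Permutations"
begin

definition int_partitions :: "nat \<Rightarrow> nat list set" where
  "int_partitions d =
     {lam. sorted_wrt (\<ge>) lam \<and> (\<forall>x\<in>set lam. 0 < x) \<and> sum_list lam = d}"

lemma finite_int_partitions: "finite (int_partitions d)"
proof (rule finite_subset)
  have len: "(\<forall>x\<in>set lam. 0 < x) \<Longrightarrow> length lam \<le> sum_list lam" for lam :: "nat list"
    by (induction lam) auto
  show "int_partitions d \<subseteq> {xs. set xs \<subseteq> {..d} \<and> length xs \<le> d}"
    using len member_le_sum_list by (fastforce simp: int_partitions_def)
  show "finite {xs. set xs \<subseteq> {..d} \<and> length xs \<le> d}"
    by (rule finite_lists_length_le) simp
qed

definition num_partitions :: "nat \<Rightarrow> nat" where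
  "num_partitions m = card (int_partitions m)"

definition part_prod :: "nat list \<Rightarrow> nat" where
  "part_prod lam = (\<Prod>j<length lam. num_partitions (lam ! j))"

text \<open>Values that are not parts have multiplicity 0 and would contribute the factor 1,
  so the product may be taken over the parts that occur.\<close>

definition aut_card :: "nat list \<Rightarrow> nat" where
  "aut_card lam = (\<Prod>i\<in>set lam. fact (count_list lam i))"

text \<open>Positions are counted from 0, so the symmetric group acts on \<open>{..<length lam}\<close> and
  the partial sum ending at position \<open>j\<close> includes \<open>j\<close>.\<close>

definition w :: "real \<Rightarrow> nat list \<Rightarrow> real" where
  "w q lam = 1 / real (aut_card lam) *
     (\<Sum>\<sigma> | \<sigma> permutes {..<length lam}.
        \<Prod>j<length lam. 1 / (q powi (- int (\<Sum>i\<le>j. lam ! \<sigma> i)) - 1))"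

definition xi_weight :: "nat \<Rightarrow> real \<Rightarrow> nat list \<Rightarrow> real" where
  "xi_weight d q lam = real (part_prod lam) * w q lam /
     (\<Sum>kap\<in>int_partitions d. real (part_prod kap) * w q kap)"

text \<open>The \<open>\<sigma>\<close>-algebra of \<^const>\<open>point_measure\<close> is the full power set.\<close>

definition xi :: "nat \<Rightarrow> real \<Rightarrow> nat list measure" where
  "xi d q = point_measure (int_partitions d) (\<lambda>lam. ennreal (xi_weight d q lam))"

definition dirac_partition :: "nat \<Rightarrow> nat list measure" where
  "dirac_partition d = return (count_space (int_partitions d)) [d]"

definition borel_prob_on :: "'b topology \<Rightarrow> 'b measure \<Rightarrow> bool" where
  "borel_prob_on X M \<longleftrightarrow> prob_space M \<and> space M = topspace X \<and>
     sets M = sigma_sets (topspace X) {U. openin X U}"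

text \<open>\<^const>\<open>weak_conv_m\<close> only covers sequences of measures on the real line; this is weak
  convergence along a filter for Borel probability measures on an arbitrary topological space,
  tested against bounded continuous real functions.\<close>

definition converges_weakly ::
    "'b topology \<Rightarrow> ('a \<Rightarrow> 'b measure) \<Rightarrow> 'b measure \<Rightarrow> 'a filter \<Rightarrow> bool" where
  "converges_weakly X M N F \<longleftrightarrow>
     (\<forall>\<^sub>F i in F. borel_prob_on X (M i)) \<and> borel_prob_on X N \<and>
     (\<forall>f :: 'b \<Rightarrow> real. continuous_map X euclideanreal f \<longrightarrow> bounded (f ` topspace X) \<longrightarrow>
        ((\<lambda>i. \<integral>x. f x \<partial>M i) \<longlongrightarrow> (\<integral>x. f x \<partial>N)) F)"

end

theory Submission imports Defs begin

text \<open>For a partition of \<open>d\<close> the last partial sum in every ordering of the parts is \<open>d\<close>, so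
  \<open>w q lam\<close> is \<open>g(d)\<close>, where \<open>g(s) = 1 / (q\<^sup>-\<^sup>s - 1)\<close>, times a sum of products of the remaining
  factors. Each of these vanishes as \<open>q \<rightarrow> 0\<close>, so \<open>w q lam / g(d)\<close> tends to 0 unless there are no
  remaining factors, that is, unless \<open>lam = [d]\<close>.\<close>

lemma one_part_in_int_partitions: "0 < d \<Longrightarrow> [d] \<in> int_partitions d"
  by (simp add: int_partitions_def)

lemma num_partitions_pos: "0 < m \<Longrightarrow> 0 < num_partitions m"
  unfolding num_partitions_def
  using one_part_in_int_partitions[of m] finite_int_partitions[of m] card_gt_0_iff by blast

lemma part_prod_pos:
  assumes "lam \<in> int_partitions d"
  shows "0 < part_prod lam"
  using assms unfolding part_prod_def int_partitions_def
  by (auto intro!: prod_pos num_partitions_pos)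

lemma aut_card_pos: "0 < aut_card lam"
  unfolding aut_card_def by (auto intro!: prod_pos)

text \<open>The function g of the overview. For 0 < q < 1 and s > 0 it is the value of the geometric
  series of the powers q^(k*s), k \<ge> 1.\<close>

definition geom_factor :: "real \<Rightarrow> nat \<Rightarrow> real" where
  "geom_factor q s = 1 / (q powi (- int s) - 1)"

lemma geom_factor_pos:
  assumes "0 < q" "q < 1" "0 < s"
  shows "0 < geom_factor q s"
proof -
  have "q ^ s < 1" using assms by (simp add: power_less_one_iff)
  then show ?thesis using assms
    by (simp add: geom_factor_def power_int_minus one_less_inverse_iff)
qed

lemma geom_factor_tendsto_0:
  assumes "0 < s"
  shows "((\<lambda>q. geom_factor q s) \<longlongrightarrow> 0) (at_right 0)"
proof -
  \<comment> \<open>The form q^s / (1 - q^s) extends continuously to q = 0: since s > 0, the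
    numerator tends to 0 and the denominator to 1.\<close>
  have "((\<lambda>q::real. q ^ s / (1 - q ^ s)) \<longlongrightarrow> 0 ^ s / (1 - 0 ^ s)) (at_right 0)"
    using assms by (intro tendsto_intros) (auto simp: power_0_left)
  moreover have "\<forall>\<^sub>F q in at_right 0. geom_factor q s = q ^ s / (1 - q ^ s)"
    using eventually_at_right_less[of "0::real"]
    by eventually_elim (simp add: geom_factor_def power_int_minus field_simps)
  ultimately show ?thesis using assms by (simp add: tendsto_cong power_0_left)
qed

lemma w_eq: "w q lam = 1 / real (aut_card lam) *
     (\<Sum>\<sigma> | \<sigma> permutes {..<length lam}.
        \<Prod>j<length lam. geom_factor q (\<Sum>i\<le>j. lam ! \<sigma> i))"
  unfolding w_def geom_factor_def ..

lemma w_one_part: "w q [d] = geom_factor q d"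
  by (simp add: w_eq aut_card_def lessThan_Suc)

text \<open>The sum contains its last term, which is a part and hence positive. Positive exponents
  are what make the factors positive on (0,1) and small near 0.\<close>

lemma partial_sum_pos:
  assumes "lam \<in> int_partitions d" "\<sigma> permutes {..<length lam}" "j < length lam"
  shows "0 < (\<Sum>i\<le>j. lam ! \<sigma> i)"
proof -
  have "\<sigma> j < length lam"
    using permutes_in_image[OF assms(2), of j] assms(3) by simp
  then have "0 < lam ! \<sigma> j" using assms(1) by (auto simp: int_partitions_def)
  then show ?thesis by (intro sum_pos2[of _ j]) auto
qed

text \<open>All summands are positive, and the identity permutation keeps the sum from being
  empty.\<close>

lemma w_pos:
  assumes "lam \<in> int_partitions d" "0 < q" "q < 1"
  shows "0 < w q lam"
  unfolding w_eq using assms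
  by (intro mult_pos_pos sum_pos prod_pos)
    (auto simp: aut_card_pos finite_permutations intro!: geom_factor_pos partial_sum_pos
      intro: permutes_id)

lemma w_last_factor:
  assumes "lam \<in> int_partitions d" "length lam = Suc n"
  shows "w q lam = geom_factor q d * (1 / real (aut_card lam) *
     (\<Sum>\<sigma> | \<sigma> permutes {..<length lam}. \<Prod>j<n. geom_factor q (\<Sum>i\<le>j. lam ! \<sigma> i)))"
proof -
  have "(\<Sum>i\<le>n. lam ! \<sigma> i) = d" if \<sigma>: "\<sigma> permutes {..<length lam}" for \<sigma>
  proof -
    have "(\<Sum>i\<le>n. lam ! \<sigma> i) = (\<Sum>i<length lam. lam ! \<sigma> i)"
      by (simp add: assms(2) lessThan_Suc_atMost)
    also have "\<dots> = (\<Sum>i<length lam. lam ! i)"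
      using sum.permute[OF \<sigma>, of "(!) lam"] by (simp add: comp_def)
    also have "\<dots> = d"
      using assms(1) by (simp add: int_partitions_def sum_list_sum_nth atLeast0LessThan)
    finally show ?thesis .
  qed
  \<comment> \<open>The product over \<open>Suc n\<close> positions splits off its factor at
    position \<open>n\<close>, which is the same for every \<sigma> and so leaves the sum.\<close>
  then show ?thesis
    unfolding w_eq sum_distrib_left by (intro sum.cong) (simp_all add: assms(2) mult_ac)
qed

lemma w_ratio_tendsto:
  assumes "0 < d" "lam \<in> int_partitions d"
  shows "((\<lambda>q. w q lam / geom_factor q d) \<longlongrightarrow> of_bool (lam = [d])) (at_right 0)"
proof -
  have ev: "\<forall>\<^sub>F q in at_right (0::real). geom_factor q d \<noteq> 0"
    using eventually_at_right_real[of 0 1, OF zero_less_one]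
    by eventually_elim (use geom_factor_pos[OF _ _ assms(1)] in force)
  show ?thesis
  proof (cases "lam = [d]")
    case True
    have "\<forall>\<^sub>F q in at_right (0::real). w q lam / geom_factor q d = 1"
      using ev by eventually_elim (simp add: True w_one_part)
    then show ?thesis using True by (simp add: tendsto_eventually)
  next
    case False
    \<comment> \<open>Length 0 would give sum 0 < d, and length 1 would force
      \<open>lam = [d]\<close>. With at least two parts, \<open>Suc n\<close> factors remain once
      the last one is divided out, so the limiting product of zeros is nonempty and
      vanishes.\<close>
    obtain n where n: "length lam = Suc (Suc n)"
    proof -
      have "length lam \<noteq> 0" using assms by (auto simp: int_partitions_def)
      moreover have "length lam \<noteq> 1"
        using assms(2) False by (auto simp: int_partitions_def length_Suc_conv)
      ultimately show ?thesis using that by (metis One_nat_def not0_implies_Suc)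
    qed
    let ?r = "\<lambda>q. 1 / real (aut_card lam) * (\<Sum>\<sigma> | \<sigma> permutes {..<length lam}.
                \<Prod>j<Suc n. geom_factor q (\<Sum>i\<le>j. lam ! \<sigma> i))"
    have "(?r \<longlongrightarrow> 1 / real (aut_card lam) *
            (\<Sum>\<sigma> | \<sigma> permutes {..<length lam}. \<Prod>j<Suc n. 0)) (at_right 0)"
      using assms(2) n
      by (intro tendsto_intros geom_factor_tendsto_0 partial_sum_pos) auto
    moreover have "\<forall>\<^sub>F q in at_right 0. w q lam / geom_factor q d = ?r q"
      using ev by eventually_elim (simp add: w_last_factor[OF assms(2) n])
    ultimately show ?thesis using False by (simp add: tendsto_cong)
  qed
qed

lemma weight_sum_pos:
  assumes "0 < d" "0 < q" "q < 1"
  shows "0 < (\<Sum>kap\<in>int_partitions d. real (part_prod kap) * w q kap)"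
  using assms one_part_in_int_partitions[of d]
  by (intro sum_pos mult_pos_pos w_pos) (auto simp: finite_int_partitions part_prod_pos)

text \<open>\<open>ennreal\<close> sends negative reals to 0, so nonnegativity ensures that the
  density of \<open>xi\<close> agrees with the weight.\<close>

lemma xi_weight_nonneg:
  assumes "0 < d" "0 < q" "q < 1" "lam \<in> int_partitions d"
  shows "0 \<le> xi_weight d q lam"
  unfolding xi_weight_def using weight_sum_pos[OF assms(1-3)] w_pos[OF assms(4,2,3)]
  by (simp add: less_imp_le)

lemma sum_xi_weight:
  assumes "0 < d" "0 < q" "q < 1"
  shows "(\<Sum>lam\<in>int_partitions d. xi_weight d q lam) = 1"
  unfolding xi_weight_def using weight_sum_pos[OF assms]
  by (simp flip: sum_divide_distrib)

text \<open>Numerator and denominator both tend to 0, so each is first divided by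
  \<open>geom_factor q d\<close>. The rescaled denominator then has a nonzero limit.\<close>

lemma xi_weight_tendsto:
  assumes "0 < d" "lam \<in> int_partitions d"
  shows "((\<lambda>q. xi_weight d q lam) \<longlongrightarrow> of_bool (lam = [d])) (at_right 0)"
proof -
  let ?r = "\<lambda>kap q. real (part_prod kap) * (w q kap / geom_factor q d)"
  let ?l = "\<lambda>kap. real (part_prod kap) * of_bool (kap = [d])"
  note one = one_part_in_int_partitions[OF assms(1)]
  \<comment> \<open>Only the one-part partition survives in the limit of the denominator, leaving
    p((d)) > 0.\<close>
  have suml: "(\<Sum>kap\<in>int_partitions d. ?l kap) = real (part_prod [d])"
    using one by (simp add: of_bool_def finite_int_partitions if_distrib cong: if_cong)
  have pos: "0 < real (part_prod [d])" using part_prod_pos[OF one] by simp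
  have "((\<lambda>q. ?r lam q / (\<Sum>kap\<in>int_partitions d. ?r kap q))
          \<longlongrightarrow> ?l lam / (\<Sum>kap\<in>int_partitions d. ?l kap)) (at_right 0)"
    using assms suml pos by (intro tendsto_intros w_ratio_tendsto) auto
  moreover have "?l lam / (\<Sum>kap\<in>int_partitions d. ?l kap) = of_bool (lam = [d])"
    unfolding suml using pos by simp
  moreover have "\<forall>\<^sub>F q in at_right 0.
      xi_weight d q lam = ?r lam q / (\<Sum>kap\<in>int_partitions d. ?r kap q)"
    using eventually_at_right_real[of 0 1, OF zero_less_one]
  proof eventually_elim
    case (elim q)
    then have "0 < geom_factor q d" using geom_factor_pos assms(1) by simp
    then show ?case by (simp add: xi_weight_def flip: sum_divide_distrib)
  qed
  ultimately show ?thesis by (simp add: tendsto_cong)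
qed

lemma space_xi: "space (xi d q) = int_partitions d"
  and sets_xi: "sets (xi d q) = Pow (int_partitions d)"
  by (simp_all add: xi_def space_point_measure sets_point_measure)

lemma prob_space_xi:
  assumes "0 < d" "0 < q" "q < 1"
  shows "prob_space (xi d q)"
proof
  show "emeasure (xi d q) (space (xi d q)) = 1"
    unfolding space_xi using assms
    by (simp add: xi_def emeasure_point_measure_finite finite_int_partitions
        sum_ennreal xi_weight_nonneg sum_xi_weight)
qed

lemma measure_xi_singleton:
  assumes "0 < d" "0 < q" "q < 1" "lam \<in> int_partitions d"
  shows "measure (xi d q) {lam} = xi_weight d q lam"
  using assms
  by (simp add: measure_def xi_def emeasure_point_measure_finite finite_int_partitions
      xi_weight_nonneg)

text \<open>Turns weak convergence into convergence of finitely many point masses.\<close>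

lemma integral_xi:
  fixes f :: "nat list \<Rightarrow> real"
  assumes "0 < d" "0 < q" "q < 1"
  shows "(\<integral>x. f x \<partial>xi d q) = (\<Sum>lam\<in>int_partitions d. xi_weight d q lam * f lam)"
  unfolding xi_def using assms
  by (simp add: lebesgue_integral_point_measure_finite finite_int_partitions xi_weight_nonneg)

text \<open>Every subset is open, and the power set is already a \<sigma>-algebra, so it is the
  Borel one.\<close>

lemma borel_prob_on_discrete_topology:
  assumes "prob_space M" "space M = S" "sets M = Pow S"
  shows "borel_prob_on (discrete_topology S) M"
proof -
  have "{U. openin (discrete_topology S) U} = Pow S" by auto
  then show ?thesis
    using assms sigma_algebra.sigma_sets_eq[OF sigma_algebra_Pow[of S]]
    by (simp add: borel_prob_on_def)
qed

text \<open>The first conjunct ties the measures \<open>xi d q\<close> to the prescribed point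
  masses for every q in (0,1), not merely for q near 0.\<close>

theorem theorem3p1:
  fixes d :: nat
  assumes "0 < d"
  shows "(\<forall>q::real. 0 < q \<and> q < 1 \<longrightarrow>
            prob_space (xi d q) \<and>
            (\<forall>lam\<in>int_partitions d. measure (xi d q) {lam} = xi_weight d q lam)) \<and>
         converges_weakly (discrete_topology (int_partitions d)) (xi d) (dirac_partition d)
           (at_right (0::real))"
proof (intro conjI allI impI ballI)
  fix q :: real assume q: "0 < q \<and> q < 1"
  then show "prob_space (xi d q)" using assms prob_space_xi by blast
  show "measure (xi d q) {lam} = xi_weight d q lam" if "lam \<in> int_partitions d" for lam
    using measure_xi_singleton assms q that by blast
next
  note one = one_part_in_int_partitions[OF assms]
  have small: "\<forall>\<^sub>F q in at_right (0::real). 0 < q \<and> q < 1"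
    using eventually_at_right_real[of 0 1, OF zero_less_one] by eventually_elim simp
  have "\<forall>\<^sub>F q in at_right 0. borel_prob_on (discrete_topology (int_partitions d)) (xi d q)"
    using small by eventually_elim
      (simp add: borel_prob_on_discrete_topology prob_space_xi assms space_xi sets_xi)
  moreover have "borel_prob_on (discrete_topology (int_partitions d)) (dirac_partition d)"
    using one by (intro borel_prob_on_discrete_topology)
      (auto simp: dirac_partition_def intro!: prob_space_return)
  moreover have "((\<lambda>q. \<integral>x. f x \<partial>xi d q) \<longlongrightarrow> (\<integral>x. f x \<partial>dirac_partition d)) (at_right 0)"
    for f :: "nat list \<Rightarrow> real"
  proof -
    \<comment> \<open>The sum is finite, so the limit is taken term by term; the limiting indicator
      weights pick out \<open>f [d]\<close>, the integral against the Dirac measure.\<close>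
    have "((\<lambda>q. \<Sum>lam\<in>int_partitions d. xi_weight d q lam * f lam)
            \<longlongrightarrow> (\<Sum>lam\<in>int_partitions d. of_bool (lam = [d]) * f lam)) (at_right 0)"
      using assms by (intro tendsto_intros xi_weight_tendsto)
    moreover have "(\<Sum>lam\<in>int_partitions d. of_bool (lam = [d]) * f lam) = f [d]"
      using one by (simp add: of_bool_def finite_int_partitions if_distribR if_distrib[of "\<lambda>c. c * _"]
          cong: if_cong)
    moreover have "(\<integral>x. f x \<partial>dirac_partition d) = f [d]"
      unfolding dirac_partition_def using one by (intro integral_return) auto
    moreover have "\<forall>\<^sub>F q in at_right 0.
        (\<integral>x. f x \<partial>xi d q) = (\<Sum>lam\<in>int_partitions d. xi_weight d q lam * f lam)"
      using small by eventually_elim (simp add: integral_xi assms)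
    ultimately show ?thesis by (simp add: tendsto_cong)
  qed
  ultimately show "converges_weakly (discrete_topology (int_partitions d)) (xi d)
      (dirac_partition d) (at_right (0::real))"
    by (simp add: converges_weakly_def)
qed

end
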